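(* Let $Z$ be a $\mathbb{C}\setminus\{0\}$-valued random variable on a probability space which has a complex harmonic mean $\mathbf{H}[Z]$, i.e. the expectation $\mathbf{E}[Z^{-1}]$ exists and is a non-zero complex number. Then $$|\mathbf{H}[Z]| \ge \mathbf{H}[|Z|].$$ Moreover, equality holds when $Z = vX$ for some constant $v \in \mathbb{C}\setminus\{0\}$ and some $(0,\infty)$-valued random variable $X$.
   Context: For a $\mathbb{C}\setminus\{0\}$-valued random variable $Z$, the complex harmonic mean is $\mathbf{H}[Z] := \mathbf{E}[Z^{-1}]^{-1}$, defined whenever the expectation $\mathbf{E}[Z^{-1}]$ exists ($Z^{-1}$ is integrable) and is a non-zero complex number. For a $(0,\infty)$-valued random variable $X$ (for instance $X=|Z|$), the classical harmonic mean is $\mathbf{H}[X] := \mathbf{E}[X^{-1}]^{-1}$, defined whenever $\mathbf{E}[X^{-1}]$ exists as a positive number. *)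

theory Defs
  imports "HOL-Probability.Probability"
begin

definition has_complex_harmonic_mean :: "'a measure \<Rightarrow> ('a \<Rightarrow> complex) \<Rightarrow> bool" where
  "has_complex_harmonic_mean M Z \<longleftrightarrow>
     integrable M (\<lambda>\<omega>. inverse (Z \<omega>)) \<and> (LINT \<omega>|M. inverse (Z \<omega>)) \<noteq> 0"

(* Meaningful only under has_complex_harmonic_mean M Z; otherwise the value is the
   default 0, since the integral of a non-integrable function and inverse 0 are both 0. *)
definition complex_harmonic_mean :: "'a measure \<Rightarrow> ('a \<Rightarrow> complex) \<Rightarrow> complex" where
  "complex_harmonic_mean M Z = inverse (LINT \<omega>|M. inverse (Z \<omega>))"

definition has_harmonic_mean :: "'a measure \<Rightarrow> ('a \<Rightarrow> real) \<Rightarrow> bool" where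
  "has_harmonic_mean M X \<longleftrightarrow>
     integrable M (\<lambda>\<omega>. inverse (X \<omega>)) \<and> (LINT \<omega>|M. inverse (X \<omega>)) > 0"

(* Meaningful only under has_harmonic_mean M X, as above. *)
definition harmonic_mean :: "'a measure \<Rightarrow> ('a \<Rightarrow> real) \<Rightarrow> real" where
  "harmonic_mean M X = inverse (LINT \<omega>|M. inverse (X \<omega>))"

end

theory Submission
  imports Defs
begin

text \<open>Since |Z^-1| = |Z|^-1, the triangle inequality for integrals
  (\<open>integral_norm_bound\<close>) gives |E[Z^-1]| \<le> E[|Z|^-1], and taking reciprocals of
  positive numbers reverses it. If Z = vX with X > 0, all values of Z^-1 lie on the single ray
  through v^-1, so no cancellation occurs: both sides equal |v|^-1 E[X^-1].\<close>

theorem theorem3p1: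
  fixes M :: "'a measure" and Z :: "'a \<Rightarrow> complex"
  assumes "prob_space M"
    and "Z \<in> borel_measurable M"
    and "\<forall>\<omega>\<in>space M. Z \<omega> \<noteq> 0"
    and "has_complex_harmonic_mean M Z"
  shows "has_harmonic_mean M (\<lambda>\<omega>. cmod (Z \<omega>)) \<and>
    cmod (complex_harmonic_mean M Z) \<ge> harmonic_mean M (\<lambda>\<omega>. cmod (Z \<omega>)) \<and>
    (\<forall>(v :: complex) (X :: 'a \<Rightarrow> real).
       v \<noteq> 0 \<and> X \<in> borel_measurable M \<and> (\<forall>\<omega>\<in>space M. X \<omega> > 0) \<and>
       (\<forall>\<omega>\<in>space M. Z \<omega> = v * complex_of_real (X \<omega>))
       \<longrightarrow> cmod (complex_harmonic_mean M Z) = harmonic_mean M (\<lambda>\<omega>. cmod (Z \<omega>)))"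
proof (intro conjI allI impI)
  let ?I = "LINT \<omega>|M. inverse (Z \<omega>)"
  let ?J = "LINT \<omega>|M. inverse (cmod (Z \<omega>))"
  have int: "integrable M (\<lambda>\<omega>. inverse (Z \<omega>))" and I0: "?I \<noteq> 0"
    using assms(4) by (auto simp: has_complex_harmonic_mean_def)
  have intJ: "integrable M (\<lambda>\<omega>. inverse (cmod (Z \<omega>)))"
    using integrable_norm[OF int] by (simp add: norm_inverse)
  have le: "cmod ?I \<le> ?J"
    using integral_norm_bound[of M "\<lambda>\<omega>. inverse (Z \<omega>)"] by (simp add: norm_inverse)
  have Ipos: "cmod ?I > 0"
    using I0 by simp
  show "has_harmonic_mean M (\<lambda>\<omega>. cmod (Z \<omega>))"
    \<comment> \<open>Positivity of \<open>?J\<close> is inherited from \<open>?I\<close> \<noteq> 0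
      through the triangle inequality.\<close>
    unfolding has_harmonic_mean_def using intJ less_le_trans[OF Ipos le] by (rule conjI)
  show "cmod (complex_harmonic_mean M Z) \<ge> harmonic_mean M (\<lambda>\<omega>. cmod (Z \<omega>))"
    using le_imp_inverse_le[OF le Ipos]
    by (simp add: complex_harmonic_mean_def harmonic_mean_def norm_inverse)
  fix v :: complex and X :: "'a \<Rightarrow> real"
  assume A: "v \<noteq> 0 \<and> X \<in> borel_measurable M \<and> (\<forall>\<omega>\<in>space M. X \<omega> > 0) \<and>
       (\<forall>\<omega>\<in>space M. Z \<omega> = v * complex_of_real (X \<omega>))"
  let ?K = "LINT \<omega>|M. inverse (X \<omega>)"
  have "?I = (LINT \<omega>|M. inverse v * complex_of_real (inverse (X \<omega>)))"
    using A by (intro Bochner_Integration.integral_cong) auto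
  \<comment> \<open>Both rewrite rules hold without an integrability side condition, so
    integrability of 1/X is not derived here.\<close>
  then have I: "?I = inverse v * complex_of_real ?K"
    by (simp only: integral_mult_right_zero integral_complex_of_real)
  have "?J = (LINT \<omega>|M. inverse (cmod v) * inverse (X \<omega>))"
    using A by (intro Bochner_Integration.integral_cong) (auto simp: norm_mult)
  then have J: "?J = inverse (cmod v) * ?K"
    by (simp only: integral_mult_right_zero)
  \<comment> \<open>The only use of the sign of \<open>?K\<close>: the modulus of
    \<open>complex_of_real ?K\<close> is |\<open>?K\<close>|, which has to be \<open>?K\<close>
    itself to match the value of \<open>?J\<close>.\<close>
  have "?K \<ge> 0"
    using A by (intro Bochner_Integration.integral_nonneg) (simp add: less_imp_le)
  then have "cmod ?I = ?J"
    unfolding I J by (simp add: norm_mult norm_inverse)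
  then show "cmod (complex_harmonic_mean M Z) = harmonic_mean M (\<lambda>\<omega>. cmod (Z \<omega>))"
    by (simp add: complex_harmonic_mean_def harmonic_mean_def norm_inverse)
qed

end
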